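(* Let $q$ be a unimodular complex number and let $(V_1,V_2)$ be a $q$-commutative pair of isometries with BCL-1 and BCL-2 $q$-tuples $(\mathcal F,\mathcal K_u;P,U,W_1,W_2)$ and $(\mathcal F_\dag,\mathcal K_{u\dag};P_\dag,U_\dag,W_{1\dag},W_{2\dag})$, respectively. Then the following are equivalent: (1) $(V_1,V_2)$ is doubly $q$-commutative; (2) $PUP^\perp=0$; (3) $P_\dag^\perp U_\dag P_\dag=0$.
   Context: A pair $(V_1,V_2)$ of operators is $q$-commutative if $V_1V_2=qV_2V_1$, and doubly $q$-commutative if in addition $V_2V_1^*=qV_1^*V_2$. Two pairs are jointly unitarily equivalent if a single unitary intertwines both components. $H^2$ is the Hardy space of the unit disk, $M_z$ is multiplication by $z$ on $H^2$, and $(R_qf)(z)=f(qz)$ on $H^2$. $P^\perp=I-P$. A BCL-1 $q$-tuple of a $q$-commutative pair of isometries $(V_1,V_2)$ is a tuple $(\mathcal F,\mathcal K_u;P,U,W_1,W_2)$ consisting of Hilbert spaces $\mathcal F,\mathcal K_u$, an orthogonal projection $P$ and a unitary $U$ in $\mathcal B(\mathcal F)$, and a $q$-commutative pair $(W_1,W_2)$ of unitaries on $\mathcal K_u$, such that $(V_1,V_2)$ is jointly unitarily equivalent to the pair $$\left((R_q\otimes P^\perp U + M_zR_q\otimes P U)\oplus W_1,\ (R_{\overline q}\otimes U^*P+R_{\overline q}M_z\otimes U^*P^\perp)\oplus W_2\right)\ \text{ on }(H^2\otimes \mathcal F)\oplus\mathcal K_u.$$ A BCL-2 $q$-tuple of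 $(V_1,V_2)$ is a tuple $(\mathcal F_\dag,\mathcal K_{u\dag};P_\dag,U_\dag,W_{1\dag},W_{2\dag})$ of the same kind (Hilbert spaces, projection, unitary, $q$-commutative pair of unitaries) such that $(V_1,V_2)$ is jointly unitarily equivalent to $$\left((R_q\otimes U_\dag^*P_\dag^\perp + M_zR_q\otimes U_\dag^*P_\dag)\oplus W_{1\dag},\ (R_{\overline q}\otimes P_\dag U_\dag+R_{\overline q}M_z\otimes P_\dag^\perp U_\dag)\oplus W_{2\dag}\right)\ \text{ on }(H^2\otimes \mathcal F_\dag)\oplus\mathcal K_{u\dag}.$$ *)

theory Defs
  imports "HOL-Complex_Analysis.Complex_Analysis"
begin

section \<open>Complex Hilbert spaces\<close>

text \<open>The distribution only has real inner product spaces. A complex one is a real one with a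
  complex scalar multiplication extending the real one and a sesquilinear form, linear in the
  first argument, whose real part is the given real inner product (so that the norm is the one
  of the sesquilinear form).\<close>

class complex_inner = real_inner +
  fixes scaleC :: "complex \<Rightarrow> 'a \<Rightarrow> 'a"  (infixr "*\<^sub>C" 75)
    and cinner :: "'a \<Rightarrow> 'a \<Rightarrow> complex"
  assumes scaleC_add_right: "c *\<^sub>C (x + y) = c *\<^sub>C x + c *\<^sub>C y"
    and scaleC_add_left: "(c + d) *\<^sub>C x = c *\<^sub>C x + d *\<^sub>C x"
    and scaleC_scaleC: "c *\<^sub>C d *\<^sub>C x = (c * d) *\<^sub>C x"
    and scaleR_scaleC: "r *\<^sub>R x = complex_of_real r *\<^sub>C x"
    and cinner_commute: "cinner x y = cnj (cinner y x)"
    and cinner_add_left: "cinner (x + y) z = cinner x z + cinner y z"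
    and cinner_scaleC_left: "cinner (c *\<^sub>C x) y = c * cinner x y"
    and Re_cinner: "Re (cinner x y) = inner x y"

class chilbert_space = complex_inner + complete_space
begin
subclass banach ..
end

lemma scaleC_one [simp]: "1 *\<^sub>C x = (x :: 'a::complex_inner)"
  using scaleR_scaleC[of 1 x] by simp

lemma scaleC_zero_left [simp]: "0 *\<^sub>C x = (0 :: 'a::complex_inner)"
  using scaleR_scaleC[of 0 x] by simp

lemma scaleC_zero_right [simp]: "c *\<^sub>C 0 = (0 :: 'a::complex_inner)"
  using scaleC_add_right[of c 0 0] by simp

lemma scaleC_minus_right: "c *\<^sub>C (- x) = - (c *\<^sub>C x)" for x :: "'a::complex_inner"
  using scaleC_add_right[of c x "- x"] by (simp add: eq_neg_iff_add_eq_0 add.commute)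

lemma scaleC_diff_right: "c *\<^sub>C (x - y) = c *\<^sub>C x - c *\<^sub>C y" for x :: "'a::complex_inner"
  using scaleC_add_right[of c x "- y"] by (simp add: scaleC_minus_right)

lemma cinner_add_right: "cinner x (y + z) = cinner x y + cinner x z"
  by (metis cinner_add_left cinner_commute complex_cnj_add)

lemma cinner_scaleC_right: "cinner x (c *\<^sub>C y) = cnj c * cinner x y"
  by (metis cinner_scaleC_left cinner_commute complex_cnj_mult)

lemma cinner_zero_left [simp]: "cinner 0 y = 0"
  using cinner_add_left[of 0 0 y] by simp

lemma cinner_zero_right [simp]: "cinner y 0 = 0"
  using cinner_add_right[of y 0 0] by simp

lemma cinner_diff_left: "cinner (x - y) z = cinner x z - cinner y z"
  using cinner_add_left[of "x - y" y z] by simp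

lemma cinner_self: "cinner x x = complex_of_real ((norm x)\<^sup>2)"
proof (rule complex_eqI)
  show "Re (cinner x x) = Re (complex_of_real ((norm x)\<^sup>2))"
    by (simp add: Re_cinner power2_norm_eq_inner)
  have "Im (cinner x x) = Im (cnj (cinner x x))"
    using cinner_commute[of x x] by simp
  then show "Im (cinner x x) = Im (complex_of_real ((norm x)\<^sup>2))" by simp
qed

lemma norm_scaleC: "norm (c *\<^sub>C x) = cmod c * norm x" for x :: "'a::complex_inner"
proof -
  have "complex_of_real ((norm (c *\<^sub>C x))\<^sup>2) = complex_of_real ((cmod c * norm x)\<^sup>2)"
    unfolding cinner_self[symmetric] cinner_scaleC_left cinner_scaleC_right
    by (simp add: cinner_self power_mult_distrib complex_norm_square[symmetric] mult.assoc[symmetric] mult.commute[of "cnj c"] del: of_real_power)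
  then have "(norm (c *\<^sub>C x))\<^sup>2 = (cmod c * norm x)\<^sup>2"
    by (simp only: of_real_eq_iff)
  then show ?thesis
    by (simp add: power2_eq_iff_nonneg)
qed

lemma norm_cinner_le: "cmod (cinner x y) \<le> norm x * norm y"
proof (cases "cinner x y = 0")
  case True
  then show ?thesis by simp
next
  case False
  define c where "c = cnj (cinner x y) / cmod (cinner x y)"
  have c: "cmod c = 1"
    using False by (simp add: c_def norm_divide)
  have "c * cinner x y = complex_of_real (cmod (cinner x y))"
    using False by (simp add: c_def field_simps complex_norm_square[symmetric] power2_eq_square)
  then have "cmod (cinner x y) = Re (cinner (c *\<^sub>C x) y)"
    by (simp add: cinner_scaleC_left)
  also have "\<dots> \<le> norm (c *\<^sub>C x) * norm y"
    by (simp add: Re_cinner norm_cauchy_schwarz)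
  finally show ?thesis using c by (simp add: norm_scaleC)
qed

instantiation complex :: chilbert_space
begin
definition scaleC_complex :: "complex \<Rightarrow> complex \<Rightarrow> complex" where "scaleC_complex = (*)"
definition cinner_complex :: "complex \<Rightarrow> complex \<Rightarrow> complex" where "cinner_complex x y = x * cnj y"
instance
  by standard
    (auto simp: scaleC_complex_def cinner_complex_def algebra_simps inner_complex_def scaleR_conv_of_real)
end

text \<open>Orthogonal direct sums are Cartesian products.\<close>

instantiation prod :: (complex_inner, complex_inner) complex_inner
begin
definition scaleC_prod :: "complex \<Rightarrow> 'a \<times> 'b \<Rightarrow> 'a \<times> 'b"
  where "scaleC_prod c x = (c *\<^sub>C fst x, c *\<^sub>C snd x)"
definition cinner_prod :: "'a \<times> 'b \<Rightarrow> 'a \<times> 'b \<Rightarrow> complex"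
  where "cinner_prod x y = cinner (fst x) (fst y) + cinner (snd x) (snd y)"
instance
proof
  fix x y :: "'a \<times> 'b"
  show "cinner x y = cnj (cinner y x)"
    by (simp add: cinner_prod_def cinner_commute[of "fst x"] cinner_commute[of "snd x"])
qed (auto simp: scaleC_prod_def cinner_prod_def scaleC_add_right scaleC_add_left scaleC_scaleC
      cinner_add_left cinner_scaleC_left distrib_left Re_cinner inner_prod_def scaleR_scaleC[symmetric]
      scaleR_prod_def)
end

instance prod :: (chilbert_space, chilbert_space) chilbert_space ..


section \<open>Operators\<close>

definition bounded_clinear :: "('a::complex_inner \<Rightarrow> 'b::complex_inner) \<Rightarrow> bool"
  where "bounded_clinear T \<longleftrightarrow> bounded_linear T \<and> (\<forall>c x. T (c *\<^sub>C x) = c *\<^sub>C T x)"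

text \<open>\<open>adj T\<close> is only meaningful for bounded linear \<open>T\<close>, for which \<open>S\<close> exists by the Riesz
  representation theorem; uniqueness is \<open>adj_eqI\<close>.\<close>

definition adj :: "('a::chilbert_space \<Rightarrow> 'b::chilbert_space) \<Rightarrow> 'b \<Rightarrow> 'a"
  where "adj T = (THE S. \<forall>x y. cinner (T x) y = cinner x (S y))"

definition isometry_op :: "('a::chilbert_space \<Rightarrow> 'b::chilbert_space) \<Rightarrow> bool"
  where "isometry_op V \<longleftrightarrow> bounded_clinear V \<and> (\<forall>x. norm (V x) = norm x)"

definition unitary_op :: "('a::chilbert_space \<Rightarrow> 'b::chilbert_space) \<Rightarrow> bool"
  where "unitary_op U \<longleftrightarrow> isometry_op U \<and> surj U"

definition orth_projection :: "('a::chilbert_space \<Rightarrow> 'a) \<Rightarrow> bool"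
  where "orth_projection P \<longleftrightarrow> bounded_clinear P \<and> P \<circ> P = P \<and>
    (\<forall>x y. cinner (P x) y = cinner x (P y))"

definition perp :: "('a::chilbert_space \<Rightarrow> 'a) \<Rightarrow> 'a \<Rightarrow> 'a"
  where "perp P = (\<lambda>x. x - P x)"

definition q_commutative ::
    "complex \<Rightarrow> ('a::chilbert_space \<Rightarrow> 'a) \<Rightarrow> ('a \<Rightarrow> 'a) \<Rightarrow> bool"
  where "q_commutative q V1 V2 \<longleftrightarrow> V1 \<circ> V2 = (\<lambda>x. q *\<^sub>C (V2 \<circ> V1) x)"

definition doubly_q_commutative ::
    "complex \<Rightarrow> ('a::chilbert_space \<Rightarrow> 'a) \<Rightarrow> ('a \<Rightarrow> 'a) \<Rightarrow> bool"
  where "doubly_q_commutative q V1 V2 \<longleftrightarrow>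
    q_commutative q V1 V2 \<and> V2 \<circ> adj V1 = (\<lambda>x. q *\<^sub>C (adj V1 \<circ> V2) x)"

definition jointly_unitarily_equivalent ::
    "('a::chilbert_space \<Rightarrow> 'a) \<times> ('a \<Rightarrow> 'a) \<Rightarrow> ('b::chilbert_space \<Rightarrow> 'b) \<times> ('b \<Rightarrow> 'b) \<Rightarrow> bool"
  where "jointly_unitarily_equivalent V T \<longleftrightarrow>
    (\<exists>\<tau>. unitary_op \<tau> \<and> \<tau> \<circ> fst V = fst T \<circ> \<tau> \<and> \<tau> \<circ> snd V = snd T \<circ> \<tau>)"

lemma adj_eqI:
  assumes "\<And>x y. cinner (T x) y = cinner x (S y)"
  shows "adj T = S"
  unfolding adj_def
proof (rule the_equality)
  show "\<forall>x y. cinner (T x) y = cinner x (S y)" using assms by blast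
  fix S' assume S': "\<forall>x y. cinner (T x) y = cinner x (S' y)"
  show "S' = S"
  proof
    fix y
    have "cinner x (S' y) = cinner x (S y)" for x
      using S' assms by metis
    then have "cinner (S' y - S y) (S' y) = cinner (S' y - S y) (S y)" by blast
    then have "cinner (S' y - S y) (S' y - S y) = 0"
      using cinner_add_right[of "S' y - S y" "S' y - S y" "S y"] by simp
    then show "S' y = S y" by (simp add: cinner_self)
  qed
qed


section \<open>Hardy spaces\<close>

definition sqsum :: "(nat \<Rightarrow> 'f::chilbert_space) \<Rightarrow> bool"
  where "sqsum a \<longleftrightarrow> summable (\<lambda>n. (norm (a n))\<^sup>2)"

text \<open>Functions on the disk are extended by 0, so that equality of functions is equality on the
  disk.\<close>

definition disk_series :: "(nat \<Rightarrow> 'f::chilbert_space) \<Rightarrow> complex \<Rightarrow> 'f"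
  where "disk_series a z = (if cmod z < 1 then (\<Sum>n. z ^ n *\<^sub>C a n) else 0)"

lemma sqsum_zero [simp]: "sqsum (\<lambda>n. 0)"
  by (simp add: sqsum_def)

lemma sqsum_add: assumes "sqsum a" "sqsum b" shows "sqsum (\<lambda>n. a n + b n)"
  unfolding sqsum_def
proof (rule summable_comparison_test')
  show "summable (\<lambda>n. 2 * (norm (a n))\<^sup>2 + 2 * (norm (b n))\<^sup>2)"
    using assms by (intro summable_add summable_mult) (auto simp: sqsum_def)
  fix n
  have "(norm (a n + b n))\<^sup>2 \<le> (norm (a n) + norm (b n))\<^sup>2"
    by (simp add: norm_triangle_ineq power_mono)
  also have "\<dots> \<le> 2 * (norm (a n))\<^sup>2 + 2 * (norm (b n))\<^sup>2"
    using zero_le_power2[of "norm (a n) - norm (b n)"] by (simp add: power2_eq_square algebra_simps)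
  finally show "norm ((norm (a n + b n))\<^sup>2) \<le> 2 * (norm (a n))\<^sup>2 + 2 * (norm (b n))\<^sup>2" by simp
qed

lemma sqsum_scaleC: assumes "sqsum a" shows "sqsum (\<lambda>n. c *\<^sub>C a n)"
  using assms unfolding sqsum_def by (simp add: norm_scaleC power_mult_distrib summable_mult)

lemma sqsum_minus: "sqsum a \<Longrightarrow> sqsum (\<lambda>n. - a n)"
  by (simp add: sqsum_def)

lemma sqsum_diff: "sqsum a \<Longrightarrow> sqsum b \<Longrightarrow> sqsum (\<lambda>n. a n - b n)"
  using sqsum_add[of a "\<lambda>n. - b n"] by (simp add: sqsum_minus)

lemma summable_cinner:
  assumes "sqsum a" "sqsum b" shows "summable (\<lambda>n. cinner (a n) (b n))"
proof (rule summable_comparison_test')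
  show "summable (\<lambda>n. (norm (a n))\<^sup>2 + (norm (b n))\<^sup>2)"
    using assms by (intro summable_add) (auto simp: sqsum_def)
  fix n
  have "cmod (cinner (a n) (b n)) \<le> norm (a n) * norm (b n)" by (rule norm_cinner_le)
  also have "\<dots> \<le> (norm (a n))\<^sup>2 + (norm (b n))\<^sup>2"
    using sum_squares_bound[of "norm (a n)" "norm (b n)"]
      mult_nonneg_nonneg[OF norm_ge_zero[of "a n"] norm_ge_zero[of "b n"]] by linarith
  finally show "norm (cinner (a n) (b n)) \<le> (norm (a n))\<^sup>2 + (norm (b n))\<^sup>2" .
qed

lemma summable_disk_series:
  fixes a :: "nat \<Rightarrow> 'f::chilbert_space"
  assumes "sqsum a" "cmod z < 1" shows "summable (\<lambda>n. z ^ n *\<^sub>C a n)"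
proof -
  have "(\<lambda>n. (norm (a n))\<^sup>2) \<longlonglongrightarrow> 0"
    using assms(1) unfolding sqsum_def by (rule summable_LIMSEQ_zero)
  then have "\<forall>\<^sub>F n in sequentially. (norm (a n))\<^sup>2 < 1"
    by (rule order_tendstoD) simp
  then obtain N where N: "\<And>n. n \<ge> N \<Longrightarrow> (norm (a n))\<^sup>2 < 1"
    by (auto simp: eventually_sequentially)
  show ?thesis
  proof (rule summable_comparison_test')
  show "summable (\<lambda>n. cmod z ^ n)" using assms by (simp add: summable_geometric)
  fix n assume "N \<le> n"
  then have "norm (a n) \<le> 1"
    using N[of n] by (simp add: abs_square_less_1[of "norm (a n)", simplified])
  then show "norm (z ^ n *\<^sub>C a n) \<le> cmod z ^ n"
    by (simp add: norm_scaleC norm_power mult_left_le)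
  qed
qed

lemma bounded_linear_scaleC: "bounded_linear (\<lambda>x::'a::complex_inner. c *\<^sub>C x)"
  by (rule bounded_linear_intro[of _ "cmod c"])
    (auto simp: scaleC_add_right norm_scaleC scaleR_scaleC scaleC_scaleC mult.commute)

lemma bounded_linear_cinner: "bounded_linear (\<lambda>x. cinner x y)"
proof (rule bounded_linear_intro[of _ "norm y"])
  show "cinner (r *\<^sub>R x) y = r *\<^sub>R cinner x y" for r x
    by (simp add: scaleR_scaleC cinner_scaleC_left scaleC_complex_def)
qed (auto simp: cinner_add_left norm_cinner_le)

lemma disk_series_eq_zeroD:
  fixes a :: "nat \<Rightarrow> 'f::chilbert_space"
  assumes a: "sqsum a" and z: "\<And>z. disk_series a z = 0"
  shows "a n = 0"
proof -
  have sums: "(\<lambda>n. cinner (a n) y * z ^ n) sums 0" if "cmod z < 1" for z y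
  proof -
    have "(\<lambda>n. z ^ n *\<^sub>C a n) sums 0"
      using summable_sums[OF summable_disk_series[OF a that]] z[of z] that
      by (simp add: disk_series_def)
    from bounded_linear.sums[OF bounded_linear_cinner this, of y]
    show ?thesis by (simp add: cinner_scaleC_left mult.commute)
  qed
  have "cinner (a n) (a n) = 0"
  proof (cases n)
    case 0
    then show ?thesis using sums[of 0 "a n"] by (simp add: powser_sums_zero_iff)
  next
    case (Suc m)
    show ?thesis
    proof (rule ccontr)
      assume "cinner (a n) (a n) \<noteq> 0"
      then obtain s where s: "0 < s" "\<And>z. z \<in> cball 0 s - {0::complex} \<Longrightarrow> (\<lambda>z. 0::complex) z \<noteq> 0"
        using powser_0_nonzero[of 1 0 "\<lambda>k. cinner (a k) (a n)" "\<lambda>z. 0" n] sums Suc by auto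
      then show False using s(2)[of "complex_of_real s"] by simp
    qed
  qed
  then show ?thesis by (simp add: cinner_self)
qed

text \<open>The Hardy space of the disk with coefficients in a Hilbert space; the scalar space $H^2$ is
  the instance \<open>complex hardy\<close>.\<close>

typedef (overloaded) ('f::chilbert_space) hardy =
  "{f :: complex \<Rightarrow> 'f. \<exists>a. sqsum a \<and> f = disk_series a}"
  by (auto intro: sqsum_zero)

setup_lifting type_definition_hardy

definition hcoeff :: "'f::chilbert_space hardy \<Rightarrow> nat \<Rightarrow> 'f"
  where "hcoeff f = (THE a. sqsum a \<and> Rep_hardy f = disk_series a)"

lemma disk_series_add:
  assumes "sqsum a" "sqsum b"
  shows "disk_series (\<lambda>n. a n + b n) = (\<lambda>z. disk_series a z + disk_series b z)"
  using assms by (auto simp: disk_series_def scaleC_add_right suminf_add[OF summable_disk_series summable_disk_series])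

lemma disk_series_scaleC:
  assumes "sqsum a"
  shows "disk_series (\<lambda>n. c *\<^sub>C a n) = (\<lambda>z. c *\<^sub>C disk_series a z)"
  using assms
  by (auto simp: disk_series_def bounded_linear.suminf[OF bounded_linear_scaleC summable_disk_series]
      scaleC_scaleC mult.commute)

lemma disk_series_minus:
  assumes "sqsum a" shows "disk_series (\<lambda>n. - a n) = (\<lambda>z. - disk_series a z)"
  using assms by (auto simp: disk_series_def scaleC_minus_right suminf_minus[OF summable_disk_series])

lemma disk_series_diff:
  assumes "sqsum a" "sqsum b"
  shows "disk_series (\<lambda>n. a n - b n) = (\<lambda>z. disk_series a z - disk_series b z)"
  using disk_series_add[OF assms(1) sqsum_minus[OF assms(2)]] disk_series_minus[OF assms(2)]
  by (simp add: fun_eq_iff)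

lemma disk_series_inj:
  assumes "sqsum a" "sqsum b" "disk_series a = disk_series b" shows "a = b"
proof
  fix n
  have "a n - b n = 0"
    by (rule disk_series_eq_zeroD[OF sqsum_diff[OF assms(1,2)]])
      (simp add: disk_series_diff assms)
  then show "a n = b n" by simp
qed

lemma hcoeff_eqI:
  assumes "sqsum a" "Rep_hardy f = disk_series a" shows "hcoeff f = a"
  unfolding hcoeff_def using assms by (intro the_equality) (auto intro: disk_series_inj)

lemma sqsum_hcoeff: "sqsum (hcoeff f)" and Rep_hardy_eq: "Rep_hardy f = disk_series (hcoeff f)"
proof -
  obtain a where "sqsum a" "Rep_hardy f = disk_series a" using Rep_hardy[of f] by auto
  then show "sqsum (hcoeff f)" "Rep_hardy f = disk_series (hcoeff f)" using hcoeff_eqI by metis+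
qed

lemma hcoeff_inject: "hcoeff f = hcoeff g \<longleftrightarrow> f = g"
  by (metis Rep_hardy_eq Rep_hardy_inject)

lemma hardy_of_coeff:
  assumes "sqsum a"
  shows "Rep_hardy (Abs_hardy (disk_series a)) = disk_series a"
    and "hcoeff (Abs_hardy (disk_series a)) = a"
proof -
  show "Rep_hardy (Abs_hardy (disk_series a)) = disk_series a"
    using assms by (intro Abs_hardy_inverse) auto
  then show "hcoeff (Abs_hardy (disk_series a)) = a" by (rule hcoeff_eqI[OF assms])
qed

instantiation hardy :: (chilbert_space) complex_inner
begin

lift_definition zero_hardy :: "'a hardy" is "\<lambda>z. 0"
  by (rule exI[of _ "\<lambda>n. 0"]) (simp add: disk_series_def fun_eq_iff)
lift_definition plus_hardy :: "'a hardy \<Rightarrow> 'a hardy \<Rightarrow> 'a hardy" is "\<lambda>f g z. f z + g z"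
  by (elim exE conjE, hypsubst) (blast intro: sqsum_add disk_series_add[symmetric])
lift_definition uminus_hardy :: "'a hardy \<Rightarrow> 'a hardy" is "\<lambda>f z. - f z"
  by (elim exE conjE, hypsubst) (blast intro: sqsum_minus disk_series_minus[symmetric])
lift_definition minus_hardy :: "'a hardy \<Rightarrow> 'a hardy \<Rightarrow> 'a hardy" is "\<lambda>f g z. f z - g z"
  by (elim exE conjE, hypsubst) (blast intro: sqsum_diff disk_series_diff[symmetric])
lift_definition scaleC_hardy :: "complex \<Rightarrow> 'a hardy \<Rightarrow> 'a hardy" is "\<lambda>c f z. c *\<^sub>C f z"
  by (elim exE conjE, hypsubst) (blast intro: sqsum_scaleC disk_series_scaleC[symmetric])
definition scaleR_hardy :: "real \<Rightarrow> 'a hardy \<Rightarrow> 'a hardy"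
  where "scaleR_hardy r f = complex_of_real r *\<^sub>C f"
definition cinner_hardy :: "'a hardy \<Rightarrow> 'a hardy \<Rightarrow> complex"
  where "cinner_hardy f g = (\<Sum>n. cinner (hcoeff f n) (hcoeff g n))"
definition inner_hardy :: "'a hardy \<Rightarrow> 'a hardy \<Rightarrow> real"
  where "inner_hardy f g = Re (cinner f g)"
definition norm_hardy :: "'a hardy \<Rightarrow> real"
  where "norm_hardy f = sqrt (inner f f)"
definition dist_hardy :: "'a hardy \<Rightarrow> 'a hardy \<Rightarrow> real"
  where "dist_hardy f g = norm (f - g)"
definition sgn_hardy :: "'a hardy \<Rightarrow> 'a hardy"
  where "sgn_hardy f = inverse (norm f) *\<^sub>R f"
definition uniformity_hardy :: "('a hardy \<times> 'a hardy) filter"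
  where "uniformity_hardy = (INF e\<in>{0 <..}. principal {(x, y). dist x y < e})"
definition open_hardy :: "'a hardy set \<Rightarrow> bool"
  where "open_hardy S = (\<forall>x\<in>S. \<forall>\<^sub>F (x', y) in uniformity. x' = x \<longrightarrow> y \<in> S)"

lemma hcoeff_add: "hcoeff (f + g) = (\<lambda>n. hcoeff f n + hcoeff g n)" for f g :: "'a hardy"
  by (rule hcoeff_eqI)
    (simp_all add: sqsum_add sqsum_hcoeff disk_series_add plus_hardy.rep_eq Rep_hardy_eq[symmetric])

lemma hcoeff_scaleC: "hcoeff (c *\<^sub>C f) = (\<lambda>n. c *\<^sub>C hcoeff f n)" for f :: "'a hardy"
  by (rule hcoeff_eqI)
    (simp_all add: sqsum_scaleC sqsum_hcoeff disk_series_scaleC scaleC_hardy.rep_eq Rep_hardy_eq[symmetric])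

lemma hcoeff_zero: "hcoeff (0 :: 'a hardy) = (\<lambda>n. 0)"
  by (rule hcoeff_eqI) (auto simp: zero_hardy.rep_eq disk_series_def)

instance
proof
  fix f g h :: "'a hardy" and c d :: complex and r s :: real
  show "f + g + h = f + (g + h)" "f + g = g + f" "0 + f = f" "- f + f = 0" "f - g = f + - g"
    by (simp_all add: Rep_hardy_inject[symmetric] plus_hardy.rep_eq minus_hardy.rep_eq
        uminus_hardy.rep_eq zero_hardy.rep_eq fun_eq_iff add_ac)
  show 1: "c *\<^sub>C (f + g) = c *\<^sub>C f + c *\<^sub>C g" "(c + d) *\<^sub>C f = c *\<^sub>C f + d *\<^sub>C f"
    "c *\<^sub>C d *\<^sub>C f = (c * d) *\<^sub>C f" for c d and f g :: "'a hardy"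
    by (simp_all add: Rep_hardy_inject[symmetric] plus_hardy.rep_eq scaleC_hardy.rep_eq fun_eq_iff
        scaleC_add_right scaleC_add_left scaleC_scaleC)
  show "r *\<^sub>R f = complex_of_real r *\<^sub>C f" by (simp add: scaleR_hardy_def)
  show "r *\<^sub>R (f + g) = r *\<^sub>R f + r *\<^sub>R g" "(r + s) *\<^sub>R f = r *\<^sub>R f + s *\<^sub>R f"
    "r *\<^sub>R s *\<^sub>R f = (r * s) *\<^sub>R f"
    by (simp_all add: scaleR_hardy_def 1)
  show "1 *\<^sub>R f = f"
    by (simp add: scaleR_hardy_def Rep_hardy_inject[symmetric] scaleC_hardy.rep_eq fun_eq_iff)
  have sm: "summable (\<lambda>n. cinner (hcoeff f n) (hcoeff g n))" for f g :: "'a hardy"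
    by (intro summable_cinner sqsum_hcoeff)
  show comm: "cinner f g = cnj (cinner g f)" for f g :: "'a hardy"
    unfolding cinner_hardy_def bounded_linear.suminf[OF bounded_linear_cnj sm]
    by (simp add: cinner_commute[symmetric])
  show add: "cinner (f + g) h = cinner f h + cinner g h"
    by (simp add: cinner_hardy_def hcoeff_add cinner_add_left suminf_add[OF sm sm])
  show scale: "cinner (c *\<^sub>C f) g = c * cinner f g" for c and f g :: "'a hardy"
    by (simp add: cinner_hardy_def hcoeff_scaleC cinner_scaleC_left suminf_mult[OF sm])
  show "Re (cinner f g) = inner f g" by (simp add: inner_hardy_def)
  show "inner f g = inner g f"
    unfolding inner_hardy_def using comm[of f g] by simp
  show "inner (f + g) h = inner f h + inner g h" by (simp add: inner_hardy_def add)
  show "inner (r *\<^sub>R f) g = r * inner f g" by (simp add: inner_hardy_def scaleR_hardy_def scale)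
  have sq: "summable (\<lambda>n. (norm (hcoeff f n))\<^sup>2)" using sqsum_hcoeff by (simp add: sqsum_def)
  have self: "inner f f = (\<Sum>n. (norm (hcoeff f n))\<^sup>2)"
    by (simp add: inner_hardy_def cinner_hardy_def cinner_self del: of_real_power
        flip: bounded_linear.suminf[OF bounded_linear_of_real sq])
  show "0 \<le> inner f f" unfolding self by (intro suminf_nonneg sq) simp
  show "inner f f = 0 \<longleftrightarrow> f = 0"
    unfolding self using suminf_eq_zero_iff[OF sq]
    by (simp add: hcoeff_inject[symmetric] hcoeff_zero fun_eq_iff)
  show "norm f = sqrt (inner f f)" by (rule norm_hardy_def)
  show "sgn f = inverse (norm f) *\<^sub>R f" by (rule sgn_hardy_def)
  show "dist f g = norm (f - g)" by (rule dist_hardy_def)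
  show "uniformity = (INF e\<in>{0 <..}. principal {(x, y::'a hardy). dist x y < e})"
    by (rule uniformity_hardy_def)
  show "open U = (\<forall>x\<in>U. \<forall>\<^sub>F (x', y) in uniformity. x' = x \<longrightarrow> y \<in> U)" for U :: "'a hardy set"
    by (rule open_hardy_def)
qed

end

lemma hcoeff_diff: "hcoeff (f - g) = (\<lambda>n. hcoeff f n - hcoeff g n)"
  by (rule hcoeff_eqI)
    (simp_all add: sqsum_diff sqsum_hcoeff disk_series_diff minus_hardy.rep_eq Rep_hardy_eq[symmetric])

lemma hardy_norm_sums: "(\<lambda>n. (norm (hcoeff f n))\<^sup>2) sums (norm f)\<^sup>2"
proof -
  have sq: "summable (\<lambda>n. (norm (hcoeff f n))\<^sup>2)" using sqsum_hcoeff by (simp add: sqsum_def)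
  have "(norm f)\<^sup>2 = Re (cinner f f)" by (simp add: cinner_self)
  also have "\<dots> = (\<Sum>n. (norm (hcoeff f n))\<^sup>2)"
    by (simp add: cinner_hardy_def cinner_self del: of_real_power
        flip: bounded_linear.suminf[OF bounded_linear_of_real sq])
  finally show ?thesis using sq summable_sums by metis
qed

lemma norm_hcoeff_le: "norm (hcoeff f n) \<le> norm f"
proof -
  have "(\<Sum>k\<in>{n}. (norm (hcoeff f k))\<^sup>2) \<le> (norm f)\<^sup>2"
    using hardy_norm_sums[of f]
    by (metis (no_types, lifting) finite.emptyI finite.insertI sum_le_suminf sums_iff zero_le_power2)
  then show ?thesis by (simp add: power2_le_iff_abs_le)
qed

instance hardy :: (chilbert_space) chilbert_space
proof
  fix X :: "nat \<Rightarrow> 'a hardy"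
  assume X: "Cauchy X"
  have C: "\<exists>M. \<forall>k\<ge>M. \<forall>l\<ge>M. norm (X k - X l) < e" if "e > 0" for e
    using X that by (auto simp: Cauchy_def dist_norm)
  have "Cauchy (\<lambda>k. hcoeff (X k) n)" for n
  proof (rule metric_CauchyI)
    fix e :: real assume "e > 0"
    then obtain M where M: "\<forall>k\<ge>M. \<forall>l\<ge>M. norm (X k - X l) < e" using C by blast
    have "dist (hcoeff (X k) n) (hcoeff (X l) n) \<le> norm (X k - X l)" for k l
      using norm_hcoeff_le[of "X k - X l" n] by (simp add: hcoeff_diff dist_norm)
    then show "\<exists>M. \<forall>k\<ge>M. \<forall>l\<ge>M. dist (hcoeff (X k) n) (hcoeff (X l) n) < e"
      using M by (meson le_less_trans)
  qed
  then have "\<exists>L. (\<lambda>k. hcoeff (X k) n) \<longlonglongrightarrow> L" for n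
    using Cauchy_convergent convergent_def by blast
  then obtain b where b: "\<And>n. (\<lambda>k. hcoeff (X k) n) \<longlonglongrightarrow> b n" by metis
  have fin: "(\<Sum>n<N. (norm (hcoeff (X k) n - b n))\<^sup>2) \<le> e\<^sup>2"
    if "\<forall>k\<ge>M. \<forall>l\<ge>M. norm (X k - X l) < e" "k \<ge> M" for e M k N
  proof (rule LIMSEQ_le_const2)
    show "(\<lambda>l. \<Sum>n<N. (norm (hcoeff (X k) n - hcoeff (X l) n))\<^sup>2)
        \<longlonglongrightarrow> (\<Sum>n<N. (norm (hcoeff (X k) n - b n))\<^sup>2)"
      by (intro tendsto_intros b)
    have "(\<Sum>n<N. (norm (hcoeff (X k) n - hcoeff (X l) n))\<^sup>2) \<le> e\<^sup>2" if "l \<ge> M" for l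
    proof -
      have "(\<Sum>n<N. (norm (hcoeff (X k - X l) n))\<^sup>2) \<le> (norm (X k - X l))\<^sup>2"
        using hardy_norm_sums[of "X k - X l"]
        by (metis (no_types, lifting) finite_lessThan sum_le_suminf sums_iff zero_le_power2)
      also have "\<dots> \<le> e\<^sup>2"
        using \<open>\<forall>k\<ge>M. \<forall>l\<ge>M. norm (X k - X l) < e\<close> \<open>k \<ge> M\<close> that
        by (intro power_mono) (auto intro: less_imp_le)
      finally show ?thesis by (simp add: hcoeff_diff)
    qed
    then show "\<exists>M. \<forall>l\<ge>M. (\<Sum>n<N. (norm (hcoeff (X k) n - hcoeff (X l) n))\<^sup>2) \<le> e\<^sup>2" by blast
  qed
  have sqd: "sqsum (\<lambda>n. hcoeff (X k) n - b n)" and led: "(\<Sum>n. (norm (hcoeff (X k) n - b n))\<^sup>2) \<le> e\<^sup>2"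
    if "\<forall>k\<ge>M. \<forall>l\<ge>M. norm (X k - X l) < e" "k \<ge> M" for e M k
  proof -
    show *: "sqsum (\<lambda>n. hcoeff (X k) n - b n)"
      unfolding sqsum_def by (rule summableI_nonneg_bounded[OF _ fin[OF that]]) simp
    show "(\<Sum>n. (norm (hcoeff (X k) n - b n))\<^sup>2) \<le> e\<^sup>2"
      using * fin[OF that] by (intro suminf_le_const) (auto simp: sqsum_def)
  qed
  obtain M1 where "\<forall>k\<ge>M1. \<forall>l\<ge>M1. norm (X k - X l) < 1" using C[of 1] by auto
  then have "sqsum (\<lambda>n. hcoeff (X M1) n - b n)" by (rule sqd) simp
  from sqsum_diff[OF sqsum_hcoeff[of "X M1"] this] have sb: "sqsum b" by simp
  define L where "L = Abs_hardy (disk_series b)"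
  have hL: "hcoeff L = b" using hardy_of_coeff[OF sb] by (simp add: L_def)
  have "X \<longlonglongrightarrow> L"
  proof (rule metric_LIMSEQ_I)
    fix e :: real assume e: "e > 0"
    then obtain M where M: "\<forall>k\<ge>M. \<forall>l\<ge>M. norm (X k - X l) < e / 2" using C[of "e/2"] by auto
    have "dist (X k) L < e" if "k \<ge> M" for k
    proof -
      have "(norm (X k - L))\<^sup>2 = (\<Sum>n. (norm (hcoeff (X k) n - b n))\<^sup>2)"
        using hardy_norm_sums[of "X k - L"] by (simp add: hcoeff_diff hL sums_iff)
      also have "\<dots> \<le> (e/2)\<^sup>2" by (rule led[OF M that])
      finally have "norm (X k - L) \<le> e / 2"
        by (rule power2_le_imp_le) (use e in simp)
      then show ?thesis using e by (simp add: dist_norm)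
    qed
    then show "\<exists>M. \<forall>k\<ge>M. dist (X k) L < e" by blast
  qed
  then show "convergent X" by (auto simp: convergent_def)
qed

type_synonym H2 = "complex hardy"

lemma Rep_H2_iff:
  fixes f :: "complex \<Rightarrow> complex"
  shows "f \<in> range Rep_hardy \<longleftrightarrow> f holomorphic_on ball 0 1 \<and> (\<forall>z. cmod z \<ge> 1 \<longrightarrow> f z = 0) \<and>
    summable (\<lambda>n. (cmod ((deriv ^^ n) f 0 / fact n))\<^sup>2)"
proof -
  have range: "range Rep_hardy = {f :: complex \<Rightarrow> complex. \<exists>a. sqsum a \<and> f = disk_series a}"
    by (rule type_definition.Rep_range[OF type_definition_hardy])
  show ?thesis
  proof
    assume "f \<in> range Rep_hardy"
    then obtain a where a: "sqsum a" "f = disk_series a" unfolding range by auto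
    have s: "(\<lambda>n. a n * (z - 0) ^ n) sums f z" if "z \<in> ball 0 1" for z
      using summable_sums[OF summable_disk_series[OF a(1), of z]] that
      by (simp add: a(2) disk_series_def scaleC_complex_def mult.commute)
    then have hol: "f holomorphic_on ball 0 1"
      by (rule power_series_holomorphic)
    have "sqsum (\<lambda>n. (deriv ^^ n) f 0 / fact n)"
    proof -
      have sd: "(\<lambda>n. (deriv ^^ n) f 0 / fact n * (z - 0) ^ n) sums f z" if "z \<in> ball 0 1" for z
        using holomorphic_power_series[OF hol that] by simp
      have "(\<lambda>n. (deriv ^^ n) f 0 / fact n) = a"
      proof
        fix n
        let ?F = "\<lambda>n. (deriv ^^ n) f 0 / fact n"
        have d: "(\<lambda>n. (?F n - a n) * (z - 0) ^ n) sums 0" if "z \<in> ball 0 1" for z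
          using sums_diff[OF sd[OF that] s[OF that]] by (simp add: algebra_simps)
        show "?F n = a n"
        proof (cases n)
          case 0
          then show ?thesis using d[of 0] powser_sums_zero_iff[of "\<lambda>n. ?F n - a n" 0] by simp
        next
          case (Suc m)
          show ?thesis
          proof (rule ccontr)
            assume "?F n \<noteq> a n"
            then obtain e where e: "0 < e" "\<And>z. z \<in> cball 0 e - {0::complex} \<Longrightarrow> (\<lambda>z. 0::complex) z \<noteq> 0"
              using powser_0_nonzero[of 1 0 "\<lambda>k. ?F k - a k" "\<lambda>z. 0" n] d Suc by auto
            then show False using e(2)[of "complex_of_real e"] by simp
          qed
        qed
      qed
      then show ?thesis using a by simp
    qed
    then show "f holomorphic_on ball 0 1 \<and> (\<forall>z. cmod z \<ge> 1 \<longrightarrow> f z = 0) \<and>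
        summable (\<lambda>n. (cmod ((deriv ^^ n) f 0 / fact n))\<^sup>2)"
      using hol a by (auto simp: sqsum_def disk_series_def)
  next
    assume f: "f holomorphic_on ball 0 1 \<and> (\<forall>z. cmod z \<ge> 1 \<longrightarrow> f z = 0) \<and>
      summable (\<lambda>n. (cmod ((deriv ^^ n) f 0 / fact n))\<^sup>2)"
    have "f = disk_series (\<lambda>n. (deriv ^^ n) f 0 / fact n)"
    proof
      fix z
      show "f z = disk_series (\<lambda>n. (deriv ^^ n) f 0 / fact n) z"
        using f holomorphic_power_series[of f 0 1 z]
        by (auto simp: disk_series_def scaleC_complex_def sums_iff mult.commute)
    qed
    then show "f \<in> range Rep_hardy" unfolding range using f by (auto simp: sqsum_def)
  qed
qed


section \<open>The Hilbert tensor product of the Hardy space with a Hilbert space\<close>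

text \<open>The Hilbert tensor product of $H^2$ and \<open>'f\<close> is realised as \<open>'f hardy\<close>, with elementary
  tensors $(f \otimes x)(z) = f(z) x$. Lemmas \<open>tensor_add_left\<close>, \<open>tensor_add_right\<close>, \<open>tensor_scaleC\<close>,
  \<open>cinner_tensor\<close> and \<open>tensor_dense\<close> say that this is a Hilbert tensor product, which determines it up to a unique unitary preserving
  elementary tensors.\<close>

lift_definition tensor :: "H2 \<Rightarrow> 'f::chilbert_space \<Rightarrow> 'f hardy"  (infixr "\<otimes>\<^sub>H" 70)
  is "\<lambda>f x z. f z *\<^sub>C x"
proof -
  fix f :: "complex \<Rightarrow> complex" and x :: 'f
  assume "\<exists>a. sqsum a \<and> f = disk_series a"
  then obtain a where a: "sqsum a" "f = disk_series a" by blast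
  have bl: "bounded_linear (\<lambda>c. c *\<^sub>C x)"
    by (rule bounded_linear_intro[of _ "norm x"])
      (auto simp: scaleC_add_left norm_scaleC scaleR_scaleC scaleC_scaleC scaleC_complex_def)
  have "sqsum (\<lambda>n. a n *\<^sub>C x)"
    using a(1) by (simp add: sqsum_def norm_scaleC power_mult_distrib summable_mult2)
  moreover have "(\<lambda>z. f z *\<^sub>C x) = disk_series (\<lambda>n. a n *\<^sub>C x)"
    using bounded_linear.suminf[OF bl summable_disk_series[OF a(1)]]
    by (auto simp: a(2) disk_series_def scaleC_scaleC scaleC_complex_def)
  ultimately show "\<exists>a. sqsum a \<and> (\<lambda>z. f z *\<^sub>C x) = disk_series a" by blast
qed

lemma hcoeff_tensor: "hcoeff (f \<otimes>\<^sub>H x) = (\<lambda>n. hcoeff f n *\<^sub>C x)"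
proof (rule hcoeff_eqI)
  have bl: "bounded_linear (\<lambda>c. c *\<^sub>C x)"
    by (rule bounded_linear_intro[of _ "norm x"])
      (auto simp: scaleC_add_left norm_scaleC scaleR_scaleC scaleC_scaleC scaleC_complex_def)
  show "sqsum (\<lambda>n. hcoeff f n *\<^sub>C x)"
    using sqsum_hcoeff[of f] by (simp add: sqsum_def norm_scaleC power_mult_distrib summable_mult2)
  show "Rep_hardy (f \<otimes>\<^sub>H x) = disk_series (\<lambda>n. hcoeff f n *\<^sub>C x)"
    using bounded_linear.suminf[OF bl summable_disk_series[OF sqsum_hcoeff[of f]]]
    by (auto simp: tensor.rep_eq Rep_hardy_eq[of f] disk_series_def scaleC_scaleC scaleC_complex_def)
qed

lemma tensor_add_left: "(f + g) \<otimes>\<^sub>H x = f \<otimes>\<^sub>H x + g \<otimes>\<^sub>H x"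
  and tensor_add_right: "f \<otimes>\<^sub>H (x + y) = f \<otimes>\<^sub>H x + f \<otimes>\<^sub>H y"
  by (simp_all add: Rep_hardy_inject[symmetric] tensor.rep_eq plus_hardy.rep_eq fun_eq_iff
      scaleC_add_left scaleC_add_right)

lemma tensor_scaleC: "(c *\<^sub>C f) \<otimes>\<^sub>H x = c *\<^sub>C (f \<otimes>\<^sub>H x)" "f \<otimes>\<^sub>H (c *\<^sub>C x) = c *\<^sub>C (f \<otimes>\<^sub>H x)"
  by (simp_all add: Rep_hardy_inject[symmetric] tensor.rep_eq scaleC_hardy.rep_eq fun_eq_iff
      scaleC_scaleC scaleC_complex_def mult.commute)

lemma cinner_tensor: "cinner (f \<otimes>\<^sub>H x) (g \<otimes>\<^sub>H y) = cinner f g * cinner x y"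
  unfolding cinner_hardy_def hcoeff_tensor
    suminf_mult2[OF summable_cinner[OF sqsum_hcoeff[of f] sqsum_hcoeff[of g]]]
  by (simp add: cinner_scaleC_left cinner_scaleC_right cinner_complex_def mult_ac)

text \<open>The real span of the elementary tensors is also their complex span, by \<open>tensor_scaleC\<close>.\<close>

lemma tensor_dense: "closure (span {f \<otimes>\<^sub>H x |f x. True}) = (UNIV :: 'f::chilbert_space hardy set)"
proof -
  have "F \<in> closure (span {f \<otimes>\<^sub>H x |f x. True})" for F :: "'f hardy"
  proof -
    define e where "e n = Abs_hardy (disk_series (\<lambda>k. if k = n then 1 else 0 :: complex))" for n
    have e: "hcoeff (e n) = (\<lambda>k. if k = n then 1 else 0)" for n
      unfolding e_def by (intro hardy_of_coeff) (auto simp: sqsum_def intro!: summable_finite[of "{n}"] split: if_splits)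
    define S where "S N = (\<Sum>n<N. e n \<otimes>\<^sub>H hcoeff F n)" for N
    have S: "S N \<in> span {f \<otimes>\<^sub>H x |f x. True}" for N
      unfolding S_def by (intro span_sum span_base) blast
    have cS: "hcoeff (S N) k = (if k < N then hcoeff F k else 0)" for N k
    proof (induction N)
      case 0
      then show ?case by (simp add: S_def hcoeff_zero)
    next
      case (Suc N)
      have "S (Suc N) = S N + e N \<otimes>\<^sub>H hcoeff F N" by (simp add: S_def)
      then show ?case using Suc by (auto simp: hcoeff_add hcoeff_tensor e less_Suc_eq)
    qed
    have sm: "summable (\<lambda>n. (norm (hcoeff F n))\<^sup>2)" using sqsum_hcoeff by (simp add: sqsum_def)
    have nS: "(norm (F - S N))\<^sup>2 = (norm F)\<^sup>2 - (\<Sum>n<N. (norm (hcoeff F n))\<^sup>2)" for N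
    proof -
      have "(\<lambda>n. (norm (hcoeff (F - S N) (n + N)))\<^sup>2) sums
          ((norm (F - S N))\<^sup>2 - (\<Sum>n<N. (norm (hcoeff (F - S N) n))\<^sup>2))"
        using hardy_norm_sums by (rule sums_split_initial_segment)
      then have 1: "(\<lambda>n. (norm (hcoeff F (n + N)))\<^sup>2) sums (norm (F - S N))\<^sup>2"
        by (simp add: hcoeff_diff cS)
      have "(\<lambda>n. (norm (hcoeff F (n + N)))\<^sup>2) sums ((norm F)\<^sup>2 - (\<Sum>n<N. (norm (hcoeff F n))\<^sup>2))"
        using hardy_norm_sums by (rule sums_split_initial_segment)
      with 1 show ?thesis by (rule sums_unique2)
    qed
    have "(\<lambda>N. (norm F)\<^sup>2 - (\<Sum>n<N. (norm (hcoeff F n))\<^sup>2)) \<longlonglongrightarrow> (norm F)\<^sup>2 - (norm F)\<^sup>2"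
      using hardy_norm_sums[of F] unfolding sums_def by (intro tendsto_intros)
    then have "(\<lambda>N. sqrt ((norm (F - S N))\<^sup>2)) \<longlonglongrightarrow> sqrt 0"
      unfolding nS by (intro tendsto_real_sqrt) simp
    then have "(\<lambda>N. norm (S N - F)) \<longlonglongrightarrow> 0" by (simp add: norm_minus_commute)
    then have "S \<longlonglongrightarrow> F" using Lim_null tendsto_norm_zero_iff by blast
    then show ?thesis using S by (auto simp: closure_sequential)
  qed
  then show ?thesis by blast
qed

text \<open>\<open>A \<otimes>\<^sub>o B\<close> is only meaningful for bounded \<open>A\<close> and \<open>B\<close>, for which the operator described exists;
  uniqueness is \<open>tensor_op_eqI\<close>.\<close>

definition tensor_op :: "(H2 \<Rightarrow> H2) \<Rightarrow> ('f::chilbert_space \<Rightarrow> 'f) \<Rightarrow> 'f hardy \<Rightarrow> 'f hardy"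
    (infixr "\<otimes>\<^sub>o" 70)
  where "A \<otimes>\<^sub>o B = (THE T. bounded_clinear T \<and> (\<forall>f x. T (f \<otimes>\<^sub>H x) = A f \<otimes>\<^sub>H B x))"

lemma tensor_op_eqI:
  fixes T :: "'f::chilbert_space hardy \<Rightarrow> 'f hardy"
  assumes "bounded_clinear T" and "\<And>f x. T (f \<otimes>\<^sub>H x) = A f \<otimes>\<^sub>H B x"
  shows "A \<otimes>\<^sub>o B = T"
  unfolding tensor_op_def
proof (rule the_equality)
  show "bounded_clinear T \<and> (\<forall>f x. T (f \<otimes>\<^sub>H x) = A f \<otimes>\<^sub>H B x)" using assms by blast
  fix S assume S: "bounded_clinear S \<and> (\<forall>f x. S (f \<otimes>\<^sub>H x) = A f \<otimes>\<^sub>H B x)"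
  have bl: "bounded_linear S" "bounded_linear T" using S assms by (auto simp: bounded_clinear_def)
  show "S = T"
  proof
    fix F :: "'f hardy"
    have sp: "S G = T G" if "G \<in> span {f \<otimes>\<^sub>H x |f x. True}" for G
      by (rule linear_eq_on[OF _ _ that]) (use bl S assms in \<open>auto simp: bounded_linear.linear\<close>)
    have "F \<in> closure (span {f \<otimes>\<^sub>H x |f x. True})" unfolding tensor_dense by simp
    then obtain X where X: "\<And>n. X n \<in> span {f \<otimes>\<^sub>H x |f x. True}" "X \<longlonglongrightarrow> F"
      unfolding closure_sequential by blast
    have "(\<lambda>n. S (X n)) \<longlonglongrightarrow> S F" "(\<lambda>n. T (X n)) \<longlonglongrightarrow> T F"
      using X(2) bl by (simp_all add: bounded_linear.tendsto)
    then show "S F = T F" using sp X(1) LIMSEQ_unique by auto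
  qed
qed


section \<open>Rotation and multiplication by the coordinate function\<close>

text \<open>For \<open>cmod q > 1\<close> the function $z \mapsto f(qz)$ need not be in the Hardy space and \<open>Rq q f\<close> is
  unspecified.\<close>

definition Rq :: "complex \<Rightarrow> H2 \<Rightarrow> H2"
  where "Rq q f = Abs_hardy (\<lambda>z. Rep_hardy f (q * z))"

definition Mz :: "H2 \<Rightarrow> H2"
  where "Mz f = Abs_hardy (\<lambda>z. z * Rep_hardy f z)"

lemma Rep_Rq: assumes "cmod q = 1" shows "Rep_hardy (Rq q f) z = Rep_hardy f (q * z)"
proof -
  have "(\<lambda>z. Rep_hardy f (q * z)) = disk_series (\<lambda>n. q ^ n * hcoeff f n)"
    using assms by (auto simp: Rep_hardy_eq disk_series_def norm_mult power_mult_distrib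
        scaleC_complex_def mult_ac)
  moreover have "sqsum (\<lambda>n. q ^ n * hcoeff f n)"
    using assms sqsum_hcoeff[of f] by (simp add: sqsum_def norm_mult norm_power)
  ultimately show ?thesis using hardy_of_coeff(1)[of "\<lambda>n. q ^ n * hcoeff f n"]
    by (metis Rq_def)
qed

lemma Rep_Mz: "Rep_hardy (Mz f) z = z * Rep_hardy f z"
proof -
  define a where "a n = (case n of 0 \<Rightarrow> 0 | Suc m \<Rightarrow> hcoeff f m)" for n
  have a: "sqsum a"
    using sqsum_hcoeff[of f] summable_Suc_iff[of "\<lambda>n. (norm (a n))\<^sup>2"] by (simp add: sqsum_def a_def)
  have "(\<lambda>z. z * Rep_hardy f z) = disk_series a"
  proof
    fix z
    show "z * Rep_hardy f z = disk_series a z"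
    proof (cases "cmod z < 1")
      case True
      have "(\<Sum>n. z ^ n *\<^sub>C a n) = (\<Sum>n. z ^ Suc n *\<^sub>C a (Suc n))"
        using suminf_split_head[OF summable_disk_series[OF a True]] by (simp add: a_def)
      also have "\<dots> = z * (\<Sum>n. z ^ n *\<^sub>C hcoeff f n)"
        by (simp add: a_def scaleC_complex_def mult.assoc
            suminf_mult[OF summable_disk_series[OF sqsum_hcoeff[of f] True, unfolded scaleC_complex_def]])
      finally show ?thesis using True by (simp add: Rep_hardy_eq disk_series_def)
    qed (simp add: Rep_hardy_eq disk_series_def)
  qed
  then show ?thesis using hardy_of_coeff(1)[OF a] by (metis Mz_def)
qed


section \<open>BCL tuples\<close>

text \<open>The Hilbert spaces of a tuple are the types \<open>'f\<close> and \<open>'k\<close>.\<close>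

definition BCL1_tuple ::
    "complex \<Rightarrow> ('h::chilbert_space \<Rightarrow> 'h) \<Rightarrow> ('h \<Rightarrow> 'h) \<Rightarrow>
     ('f::chilbert_space \<Rightarrow> 'f) \<Rightarrow> ('f \<Rightarrow> 'f) \<Rightarrow> ('k::chilbert_space \<Rightarrow> 'k) \<Rightarrow> ('k \<Rightarrow> 'k) \<Rightarrow> bool"
  where "BCL1_tuple q V1 V2 P U W1 W2 \<longleftrightarrow>
    orth_projection P \<and> unitary_op U \<and>
    unitary_op W1 \<and> unitary_op W2 \<and> q_commutative q W1 W2 \<and>
    jointly_unitarily_equivalent (V1, V2)
      (map_prod (\<lambda>F. (Rq q \<otimes>\<^sub>o (perp P \<circ> U)) F + ((Mz \<circ> Rq q) \<otimes>\<^sub>o (P \<circ> U)) F) W1,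
       map_prod (\<lambda>F. (Rq (cnj q) \<otimes>\<^sub>o (adj U \<circ> P)) F + ((Rq (cnj q) \<circ> Mz) \<otimes>\<^sub>o (adj U \<circ> perp P)) F) W2)"

definition BCL2_tuple ::
    "complex \<Rightarrow> ('h::chilbert_space \<Rightarrow> 'h) \<Rightarrow> ('h \<Rightarrow> 'h) \<Rightarrow>
     ('f::chilbert_space \<Rightarrow> 'f) \<Rightarrow> ('f \<Rightarrow> 'f) \<Rightarrow> ('k::chilbert_space \<Rightarrow> 'k) \<Rightarrow> ('k \<Rightarrow> 'k) \<Rightarrow> bool"
  where "BCL2_tuple q V1 V2 P U W1 W2 \<longleftrightarrow>
    orth_projection P \<and> unitary_op U \<and>
    unitary_op W1 \<and> unitary_op W2 \<and> q_commutative q W1 W2 \<and>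
    jointly_unitarily_equivalent (V1, V2)
      (map_prod (\<lambda>F. (Rq q \<otimes>\<^sub>o (adj U \<circ> perp P)) F + ((Mz \<circ> Rq q) \<otimes>\<^sub>o (adj U \<circ> P)) F) W1,
       map_prod (\<lambda>F. (Rq (cnj q) \<otimes>\<^sub>o (P \<circ> U)) F + ((Rq (cnj q) \<circ> Mz) \<otimes>\<^sub>o (perp P \<circ> U)) F) W2)"

end

theory Submission
  imports Defs
begin

text \<open>Both models are instances of one pair: with \<open>D\<close>, \<open>C\<close> the adjoints of \<open>A\<close>, \<open>B\<close>, put
  $T_1 = R_q \otimes A + M_z R_q \otimes B$ and
  $T_2 = R_{\bar q} \otimes C + R_{\bar q} M_z \otimes D$. On Taylor coefficients,
  $(T_1^* F)_n = \bar q^n (D F_n + C F_{n+1})$ and $(T_2 F)_n = \bar q^n (C F_n + D F_{n-1})$ with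
  $F_{-1} = 0$. Hence $T_2 T_1^* F$ and $q T_1^* T_2 F$ agree in every coefficient except the one
  of index 0, where they differ by $q D C F_0$. The unitary summand doubly \<open>q\<close>-commutes
  automatically, so double \<open>q\<close>-commutativity of the model means $D C = 0$, that is
  $U^* P^\perp U^* P = 0$ for BCL-1 and $P_\dag^\perp U_\dag P_\dag U_\dag = 0$ for BCL-2.\<close>

section \<open>Bounded operators and adjoints\<close>

lemma bounded_clinearD:
  assumes "bounded_clinear T"
  shows "T (x + y) = T x + T y" and "T (c *\<^sub>C x) = c *\<^sub>C T x" and "T 0 = 0" and "T (x - y) = T x - T y"
  using assms
  by (auto simp: bounded_clinear_def bounded_linear.linear linear_add linear_0 linear_diff)

lemma bounded_clinearI:
  assumes "\<And>x y. T (x + y) = T x + T y" and scale: "\<And>c x. T (c *\<^sub>C x) = c *\<^sub>C T x"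
    and "\<And>x. norm (T x) \<le> norm x * K"
  shows "bounded_clinear T"
  unfolding bounded_clinear_def
proof
  show "bounded_linear T"
    by (rule bounded_linear_intro[of _ K]) (use assms in \<open>auto simp: scaleR_scaleC\<close>)
qed (use scale in blast)

lemma bounded_clinear_comp:
  "bounded_clinear S \<Longrightarrow> bounded_clinear T \<Longrightarrow> bounded_clinear (S \<circ> T)"
  unfolding bounded_clinear_def using bounded_linear_compose[of S T] by (auto simp: comp_def)

lemma bounded_clinear_perp: "bounded_clinear P \<Longrightarrow> bounded_clinear (perp P)"
  unfolding bounded_clinear_def perp_def
  by (auto intro: bounded_linear_sub bounded_linear_ident simp: scaleC_diff_right)

lemma cinner_diff_right: "cinner x (y - z) = cinner x y - cinner x z"
  using cinner_add_right[of x "y - z" z] by simp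

lemma eq_zero_if_cinner_zero: "(\<And>y. cinner x y = 0) \<Longrightarrow> x = 0"
  by (metis cinner_self of_real_eq_0_iff power_eq_0_iff norm_eq_zero)

lemma scaleC_eq_zero: "c *\<^sub>C x = 0 \<Longrightarrow> c \<noteq> 0 \<Longrightarrow> x = 0"
  by (metis norm_scaleC norm_eq_zero mult_eq_0_iff)

text \<open>Polarization: the norms of \<open>x + y\<close>, \<open>x\<close> and \<open>y\<close>
  determine the real part of the form. The imaginary part is the real part at
  \<open>(- \<i>) *\<^sub>C x\<close>, and \<open>V\<close> commutes with this scalar.\<close>

lemma cinner_isometry_op:
  assumes "isometry_op V" shows "cinner (V x) (V y) = cinner x y"
proof -
  have lin: "bounded_clinear V" and nrm: "\<And>x. norm (V x) = norm x"
    using assms by (auto simp: isometry_op_def)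
  have inn: "inner (V x) (V y) = inner x y" for x y
    using nrm[of "x + y"] nrm[of x] nrm[of y]
    by (simp add: norm_eq_sqrt_inner bounded_clinearD(1)[OF lin] inner_add_left inner_add_right
        inner_commute)
  have Im: "Im (cinner x y) = Re (cinner ((- \<i>) *\<^sub>C x) y)" for x y :: "'z::complex_inner"
    by (simp add: cinner_scaleC_left)
  show ?thesis
  proof (rule complex_eqI)
    show "Re (cinner (V x) (V y)) = Re (cinner x y)" by (simp add: Re_cinner inn)
    show "Im (cinner (V x) (V y)) = Im (cinner x y)"
      unfolding Im bounded_clinearD(2)[OF lin, symmetric] by (simp add: Re_cinner inn)
  qed
qed

text \<open>Since \<open>adj\<close> is a definite description, a candidate must be exhibited:
  \<open>inv U\<close> satisfies the adjoint identity because \<open>U\<close> preserves the form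
  and is onto.\<close>

lemma unitary_op_adj:
  assumes "unitary_op U"
  shows cinner_adj_unitary: "cinner (U x) y = cinner x (adj U y)"
    and adj_unitary_cancel: "adj U (U x) = x" "U (adj U y) = y"
    and isometry_op_adj_unitary: "isometry_op (adj U)"
proof -
  have iso: "isometry_op U" and "surj U" using assms by (auto simp: unitary_op_def)
  then have lin: "bounded_clinear U" by (simp add: isometry_op_def)
  have "inj U"
  proof (rule injI)
    fix x y assume "U x = U y"
    then have "norm (U (x - y)) = 0" by (simp add: bounded_clinearD(4)[OF lin])
    then have "norm (x - y) = 0" using iso by (metis isometry_op_def)
    then show "x = y" by simp
  qed
  have surj: "U (inv U y) = y" for y using \<open>surj U\<close> by (rule surj_f_inv_f)
  have *: "cinner (U x) y = cinner x (inv U y)" for x y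
    using cinner_isometry_op[OF iso, of x "inv U y"] surj by simp
  have adj: "adj U = inv U" by (rule adj_eqI) (rule *)
  show "cinner (U x) y = cinner x (adj U y)" by (simp add: adj *)
  show "adj U (U x) = x" using \<open>inj U\<close> by (simp add: adj)
  show "U (adj U y) = y" by (simp add: adj surj)
  have nrm: "norm (inv U y) = norm y" for y using iso surj by (metis isometry_op_def)
  have "bounded_clinear (inv U)"
    by (rule bounded_clinearI[of _ 1])
      (simp_all add: nrm inv_f_eq[OF \<open>inj U\<close>] bounded_clinearD[OF lin] surj)
  then show "isometry_op (adj U)" using nrm by (simp add: adj isometry_op_def)
qed

section \<open>Tensor products of weighted shifts with operators\<close>

lemma sqsum_shift: "sqsum a \<Longrightarrow> sqsum (\<lambda>n. a (n + k))"
  by (simp add: sqsum_def summable_iff_shift[of "\<lambda>n. (norm (a n))\<^sup>2"])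

lemma sqsum_le:
  assumes "sqsum a" and "\<And>n. norm (b n) \<le> norm (a n) * K"
  shows "sqsum b"
  unfolding sqsum_def
proof (rule summable_comparison_test')
  show "summable (\<lambda>n. (norm (a n))\<^sup>2 * K\<^sup>2)"
    using assms(1) by (simp add: sqsum_def summable_mult2)
  show "norm ((norm (b n))\<^sup>2) \<le> (norm (a n))\<^sup>2 * K\<^sup>2" for n
    using power_mono[OF assms(2)[of n] norm_ge_zero, of 2] by (simp add: power_mult_distrib)
qed

text \<open>Parseval: the vanishing coefficients below \<open>k\<close> contribute nothing, so the
  shifted sequence still sums to the square of the norm.\<close>

lemma norm_hardy_le:
  assumes "\<And>n. norm (hcoeff G (n + k)) \<le> norm (hcoeff F n) * K" and "\<And>n. n < k \<Longrightarrow> hcoeff G n = 0"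
    and "K \<ge> 0"
  shows "norm G \<le> norm F * K"
proof -
  have "(\<lambda>n. (norm (hcoeff G (n + k)))\<^sup>2) sums ((norm G)\<^sup>2 - (\<Sum>n<k. (norm (hcoeff G n))\<^sup>2))"
    using hardy_norm_sums by (rule sums_split_initial_segment)
  then have 1: "(\<lambda>n. (norm (hcoeff G (n + k)))\<^sup>2) sums (norm G)\<^sup>2"
    by (simp add: assms(2))
  have 2: "(\<lambda>n. (norm (hcoeff F n))\<^sup>2 * K\<^sup>2) sums ((norm F)\<^sup>2 * K\<^sup>2)"
    using hardy_norm_sums by (rule sums_mult2)
  have "(norm G)\<^sup>2 \<le> (norm F)\<^sup>2 * K\<^sup>2"
    by (rule sums_le[OF _ 1 2]) (metis assms(1) norm_ge_zero power_mono power_mult_distrib)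
  then show ?thesis
    using assms(3) by (auto intro: power2_le_imp_le simp: power_mult_distrib)
qed

text \<open>Common shape of the scalar factors of both models in the Taylor basis. The weight is
  indexed by the output coefficient, and its bound makes the tensor product with a bounded operator
  bounded.\<close>

definition weighted_shift :: "nat \<Rightarrow> (nat \<Rightarrow> complex) \<Rightarrow> (H2 \<Rightarrow> H2) \<Rightarrow> bool"
  where "weighted_shift k w A \<longleftrightarrow> (\<forall>n. cmod (w n) \<le> 1) \<and>
    (\<forall>f n. hcoeff (A f) n = (if n < k then 0 else w n * hcoeff f (n - k)))"

text \<open>The operator \<open>T\<close> defined by this coefficient formula is bounded and has the
  right values on elementary tensors, so by uniqueness it is
  \<open>A \<otimes>\<^sub>o B\<close>.\<close>

lemma hcoeff_tensor_op:
  fixes B :: "'f::chilbert_space \<Rightarrow> 'f"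
  assumes A: "weighted_shift k w A" and B: "bounded_clinear B"
  shows "hcoeff ((A \<otimes>\<^sub>o B) F) n = (if n < k then 0 else w n *\<^sub>C B (hcoeff F (n - k)))"
proof -
  obtain K where K: "\<And>x. norm (B x) \<le> norm x * K" "K > 0"
    using bounded_linear.pos_bounded B unfolding bounded_clinear_def by blast
  have wB: "norm (w n *\<^sub>C B x) \<le> norm x * K" for n x
    using mult_mono[of "cmod (w n)" 1, OF _ K(1)[of x]] A
    by (simp add: norm_scaleC weighted_shift_def)
  define a where "a F n = (if n < k then 0 else w n *\<^sub>C B (hcoeff F (n - k)))" for F n
  define T where "T F = Abs_hardy (disk_series (a F))" for F
  have "sqsum (a F)" for F
  proof -
    \<comment> \<open>Only the tail from index \<open>k\<close> on is compared with
      \<open>F\<close>; finitely many terms do not affect summability.\<close>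
    have "sqsum (\<lambda>n. a F (n + k))"
      by (rule sqsum_le[OF sqsum_hcoeff[of F], of _ K]) (simp add: a_def wB)
    then show ?thesis
      unfolding sqsum_def summable_iff_shift[of "\<lambda>n. (norm (a F n))\<^sup>2" k] .
  qed
  then have T: "hcoeff (T F) = a F" for F
    unfolding T_def by (rule hardy_of_coeff)
  have "A \<otimes>\<^sub>o B = T"
  proof (rule tensor_op_eqI)
    show "bounded_clinear T"
    proof (rule bounded_clinearI)
      show "T (F + G) = T F + T G" for F G
        by (simp add: hcoeff_inject[symmetric] T hcoeff_add a_def fun_eq_iff bounded_clinearD[OF B]
            scaleC_add_right)
      show "T (c *\<^sub>C F) = c *\<^sub>C T F" for c F
        by (simp add: hcoeff_inject[symmetric] T hcoeff_scaleC a_def fun_eq_iff bounded_clinearD[OF B]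
            scaleC_scaleC mult.commute)
      show "norm (T F) \<le> norm F * K" for F
        by (rule norm_hardy_le[of _ k]) (use K(2) in \<open>auto simp: T a_def wB\<close>)
    qed
    show "T (f \<otimes>\<^sub>H x) = A f \<otimes>\<^sub>H B x" for f x
      using A by (simp add: hcoeff_inject[symmetric] T hcoeff_tensor a_def fun_eq_iff
          bounded_clinearD[OF B] scaleC_scaleC weighted_shift_def)
  qed
  then show ?thesis by (simp add: T a_def)
qed

text \<open>The adjoint is the backward shift by \<open>k\<close> with conjugated weights. The form
  identity is what \<open>adj_eqI\<close> asks for later.\<close>

lemma tensor_op_has_adjoint:
  fixes B C :: "'f::chilbert_space \<Rightarrow> 'f"
  assumes A: "weighted_shift k w A" and B: "bounded_clinear B" and C: "bounded_clinear C"
    and adj: "\<And>x y. cinner (B x) y = cinner x (C y)"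
  obtains S where "\<And>F G. cinner ((A \<otimes>\<^sub>o B) F) G = cinner F (S G)"
    and "\<And>G n. hcoeff (S G) n = cnj (w (n + k)) *\<^sub>C C (hcoeff G (n + k))"
proof
  obtain K where K: "\<And>x. norm (C x) \<le> norm x * K" "K > 0"
    using bounded_linear.pos_bounded C unfolding bounded_clinear_def by blast
  define S where
    "S G = Abs_hardy (disk_series (\<lambda>n. cnj (w (n + k)) *\<^sub>C C (hcoeff G (n + k))))" for G
  have "sqsum (\<lambda>n. cnj (w (n + k)) *\<^sub>C C (hcoeff G (n + k)))" for G
  proof (rule sqsum_le[OF sqsum_shift[OF sqsum_hcoeff[of G], of k], of _ K])
    show "norm (cnj (w (n + k)) *\<^sub>C C (hcoeff G (n + k))) \<le> norm (hcoeff G (n + k)) * K" for n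
      using mult_mono[of "cmod (w (n + k))" 1, OF _ K(1)[of "hcoeff G (n + k)"]] A
      by (simp add: norm_scaleC weighted_shift_def)
  qed
  then have "hcoeff (S G) = (\<lambda>n. cnj (w (n + k)) *\<^sub>C C (hcoeff G (n + k)))" for G
    unfolding S_def by (rule hardy_of_coeff)
  then show S: "hcoeff (S G) n = cnj (w (n + k)) *\<^sub>C C (hcoeff G (n + k))" for G n by simp
  show "cinner ((A \<otimes>\<^sub>o B) F) G = cinner F (S G)" for F G
  proof -
    let ?T = "(A \<otimes>\<^sub>o B) F"
    have "cinner ?T G = (\<Sum>n. cinner (hcoeff ?T (n + k)) (hcoeff G (n + k)))"
      unfolding cinner_hardy_def
      \<comment> \<open>The first \<open>k\<close> terms vanish because \<open>A\<close> shifts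
        forward by \<open>k\<close>.\<close>
      by (subst suminf_split_initial_segment[OF summable_cinner[OF sqsum_hcoeff sqsum_hcoeff], of _ _ k])
        (simp add: hcoeff_tensor_op[OF A B])
    also have "\<dots> = cinner F (S G)"
      unfolding cinner_hardy_def
      by (simp add: hcoeff_tensor_op[OF A B] S cinner_scaleC_left cinner_scaleC_right adj)
    finally show ?thesis .
  qed
qed

section \<open>Taylor coefficients of rotation and of multiplication by the coordinate\<close>

lemma hcoeff_Rq: assumes "cmod q = 1" shows "hcoeff (Rq q f) n = q ^ n * hcoeff f n"
proof -
  have "hcoeff (Rq q f) = (\<lambda>n. q ^ n * hcoeff f n)"
  proof (rule hcoeff_eqI)
    show "sqsum (\<lambda>n. q ^ n * hcoeff f n)"
      using assms sqsum_hcoeff[of f] by (simp add: sqsum_def norm_mult norm_power)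
    show "Rep_hardy (Rq q f) = disk_series (\<lambda>n. q ^ n * hcoeff f n)"
      using assms by (auto simp: Rep_Rq[OF assms] Rep_hardy_eq[of f] disk_series_def norm_mult
          power_mult_distrib scaleC_complex_def mult_ac)
  qed
  then show ?thesis by simp
qed

lemma hcoeff_Mz: "hcoeff (Mz f) n = (if n < 1 then 0 else hcoeff f (n - 1))"
proof -
  define a where "a n = (if n < 1 then 0 else hcoeff f (n - 1))" for n
  have a: "sqsum a"
    using sqsum_hcoeff[of f] summable_Suc_iff[of "\<lambda>n. (norm (a n))\<^sup>2"] by (simp add: sqsum_def a_def)
  have "hcoeff (Mz f) = a"
  proof (rule hcoeff_eqI[OF a], rule ext)
    fix z
    show "Rep_hardy (Mz f) z = disk_series a z"
    proof (cases "cmod z < 1")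
      case True
      have "(\<Sum>n. z ^ n *\<^sub>C a n) = (\<Sum>n. z ^ Suc n *\<^sub>C a (Suc n))"
        using suminf_split_head[OF summable_disk_series[OF a True]] by (simp add: a_def)
      also have "\<dots> = z * (\<Sum>n. z ^ n *\<^sub>C hcoeff f n)"
        by (simp add: a_def scaleC_complex_def mult.assoc
            suminf_mult[OF summable_disk_series[OF sqsum_hcoeff[of f] True, unfolded scaleC_complex_def]])
      finally show ?thesis using True by (simp add: Rep_Mz Rep_hardy_eq[of f] disk_series_def)
    qed (simp add: Rep_Mz Rep_hardy_eq[of f] disk_series_def)
  qed
  then show ?thesis by (simp add: a_def)
qed

text \<open>Rotating before the shift turns the old index \<open>n - 1\<close> into the exponent,
  rotating after it the new index \<open>n\<close>.\<close>

lemma weighted_shift_Rq_Mz: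
  assumes "cmod q = 1"
  shows "weighted_shift 0 (\<lambda>n. q ^ n) (Rq q)"
    and "weighted_shift 1 (\<lambda>n. q ^ (n - 1)) (Mz \<circ> Rq q)"
    and "weighted_shift 1 (\<lambda>n. q ^ n) (Rq q \<circ> Mz)"
  using assms by (auto simp: weighted_shift_def norm_power hcoeff_Rq hcoeff_Mz)

section \<open>Double q-commutativity of the model pair\<close>

text \<open>Evaluating the q-relation at \<open>adj W1 x\<close> and cancelling \<open>W1\<close>
  gives the second relation, so the unitary summand imposes no condition.\<close>

lemma unitary_doubly_q_commutative:
  assumes W1: "unitary_op W1" and W2: "bounded_clinear W2" and W: "q_commutative q W1 W2"
  shows "W2 (adj W1 x) = q *\<^sub>C adj W1 (W2 x)"
proof -
  have lin: "bounded_clinear (adj W1)"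
    using isometry_op_adj_unitary[OF W1] by (simp add: isometry_op_def)
  have "W1 (W2 (adj W1 x)) = q *\<^sub>C W2 x"
    using fun_cong[OF W[unfolded q_commutative_def], of "adj W1 x"] by (simp add: adj_unitary_cancel[OF W1])
  then have "adj W1 (W1 (W2 (adj W1 x))) = q *\<^sub>C adj W1 (W2 x)"
    by (simp add: bounded_clinearD[OF lin])
  then show ?thesis by (simp add: adj_unitary_cancel[OF W1])
qed

lemma model_doubly_q_commutative_iff:
  fixes A B C D :: "'f::chilbert_space \<Rightarrow> 'f" and W1 W2 :: "'k::chilbert_space \<Rightarrow> 'k"
    and V1 V2 :: "'h::chilbert_space \<Rightarrow> 'h"
  assumes q: "cmod q = 1"
    and lin: "bounded_clinear A" "bounded_clinear B" "bounded_clinear C" "bounded_clinear D"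
    and AD: "\<And>x y. cinner (A x) y = cinner x (D y)" and BC: "\<And>x y. cinner (B x) y = cinner x (C y)"
    and W: "unitary_op W1" "unitary_op W2" "q_commutative q W1 W2"
    and equiv: "jointly_unitarily_equivalent (V1, V2)
      (map_prod (\<lambda>F. (Rq q \<otimes>\<^sub>o A) F + ((Mz \<circ> Rq q) \<otimes>\<^sub>o B) F) W1,
       map_prod (\<lambda>F. (Rq (cnj q) \<otimes>\<^sub>o C) F + ((Rq (cnj q) \<circ> Mz) \<otimes>\<^sub>o D) F) W2)"
    and V: "q_commutative q V1 V2"
  shows "doubly_q_commutative q V1 V2 \<longleftrightarrow> (\<forall>x. D (C x) = 0)"
proof -
  define T1 where "T1 F = (Rq q \<otimes>\<^sub>o A) F + ((Mz \<circ> Rq q) \<otimes>\<^sub>o B) F" for F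
  define T2 where "T2 F = (Rq (cnj q) \<otimes>\<^sub>o C) F + ((Rq (cnj q) \<circ> Mz) \<otimes>\<^sub>o D) F" for F
  have q': "cmod (cnj q) = 1" using q by simp
  have qq: "q * cnj q = 1" using q by (simp add: complex_norm_square[symmetric])
  obtain \<tau> where \<tau>: "unitary_op \<tau>" and \<tau>1: "\<And>x. \<tau> (V1 x) = map_prod T1 W1 (\<tau> x)"
    and \<tau>2: "\<And>x. \<tau> (V2 x) = map_prod T2 W2 (\<tau> x)"
    using equiv unfolding jointly_unitarily_equivalent_def T1_def[abs_def] T2_def[abs_def]
    by (auto simp: fun_eq_iff)
  obtain R where R: "\<And>F G. cinner ((Rq q \<otimes>\<^sub>o A) F) G = cinner F (R G)"
    "\<And>G n. hcoeff (R G) n = cnj q ^ n *\<^sub>C D (hcoeff G n)"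
    using tensor_op_has_adjoint[OF weighted_shift_Rq_Mz(1)[OF q] lin(1,4) AD] by auto
  \<comment> \<open>The weight at index \<open>n + 1\<close> is \<open>q ^ n\<close>, so
    \<open>R\<close> and \<open>R'\<close> carry the same factor at index \<open>n\<close>.\<close>
  obtain R' where R': "\<And>F G. cinner (((Mz \<circ> Rq q) \<otimes>\<^sub>o B) F) G = cinner F (R' G)"
    "\<And>G n. hcoeff (R' G) n = cnj q ^ n *\<^sub>C C (hcoeff G (Suc n))"
    using tensor_op_has_adjoint[OF weighted_shift_Rq_Mz(2)[OF q] lin(2,3) BC] by auto
  define S where "S G = R G + R' G" for G
  have S: "cinner (T1 F) G = cinner F (S G)" for F G
    by (simp add: T1_def S_def cinner_add_left cinner_add_right R R')
  have cS: "hcoeff (S G) n = cnj q ^ n *\<^sub>C (D (hcoeff G n) + C (hcoeff G (Suc n)))" for G n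
    by (simp add: S_def hcoeff_add R R' scaleC_add_right)
  have cT2: "hcoeff (T2 G) n
      = cnj q ^ n *\<^sub>C (C (hcoeff G n) + (if n = 0 then 0 else D (hcoeff G (n - 1))))" for G n
    by (simp add: T2_def hcoeff_add scaleC_add_right hcoeff_tensor_op[OF weighted_shift_Rq_Mz(1)[OF q'] lin(3)]
        hcoeff_tensor_op[OF weighted_shift_Rq_Mz(3)[OF q'] lin(4)])
  note linD = bounded_clinearD[OF lin(3)] bounded_clinearD[OF lin(4)]
  \<comment> \<open>For \<open>n > 0\<close> the terms in \<open>D D\<close>, \<open>D C\<close>,
    \<open>C D\<close> and \<open>C C\<close> match, as \<open>q\<close> cancels one factor
    \<open>cnj q\<close>. At \<open>n = 0\<close> the side \<open>T2 (S F)\<close> has no term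
    beginning with \<open>D\<close>, so \<open>D C\<close> survives.\<close>
  have diff: "hcoeff (q *\<^sub>C S (T2 F)) n - hcoeff (T2 (S F)) n
      = (if n = 0 then q *\<^sub>C D (C (hcoeff F 0)) else 0)" for F n
  proof -
    let ?r = "cnj q"
    have e: "q * (?r * a) = a" for a using qq by (metis mult.assoc mult_1)
    show ?thesis
    proof (cases n)
      case 0
      then show ?thesis
        by (simp add: hcoeff_scaleC cS cT2 linD scaleC_scaleC scaleC_add_right qq)
    next
      case (Suc m)
      show ?thesis unfolding Suc
        by (simp add: hcoeff_scaleC cS cT2 linD scaleC_scaleC scaleC_add_right e mult_ac)
    qed
  qed
  have model: "T2 (S F) = q *\<^sub>C S (T2 F) \<longleftrightarrow> D (C (hcoeff F 0)) = 0" for F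
  proof -
    have "T2 (S F) = q *\<^sub>C S (T2 F) \<longleftrightarrow> (\<forall>n. hcoeff (q *\<^sub>C S (T2 F)) n - hcoeff (T2 (S F)) n = 0)"
      unfolding hcoeff_inject[symmetric] by (auto simp: fun_eq_iff)
    also have "\<dots> \<longleftrightarrow> q *\<^sub>C D (C (hcoeff F 0)) = 0" unfolding diff by simp
    also have "\<dots> \<longleftrightarrow> D (C (hcoeff F 0)) = 0" using scaleC_eq_zero q by fastforce
    finally show ?thesis .
  qed
  \<comment> \<open>The adjoint of the model is carried back to that of \<open>V1\<close> along
    \<tau>.\<close>
  have "cinner (V1 x) y = cinner x (adj \<tau> (map_prod S (adj W1) (\<tau> y)))" for x y
  proof -
    have "cinner (V1 x) y = cinner (\<tau> (V1 x)) (\<tau> y)"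
      using \<tau> by (simp add: cinner_isometry_op unitary_op_def)
    also have "\<dots> = cinner (\<tau> x) (map_prod S (adj W1) (\<tau> y))"
      by (simp add: \<tau>1 cinner_prod_def S cinner_adj_unitary[OF W(1)])
    also have "\<dots> = cinner x (adj \<tau> (map_prod S (adj W1) (\<tau> y)))"
      by (rule cinner_adj_unitary[OF \<tau>])
    finally show ?thesis .
  qed
  then have "adj V1 = (\<lambda>y. adj \<tau> (map_prod S (adj W1) (\<tau> y)))" by (rule adj_eqI)
  then have adjV: "\<tau> (adj V1 x) = map_prod S (adj W1) (\<tau> x)" for x
    by (simp add: adj_unitary_cancel[OF \<tau>])
  have \<tau>lin: "bounded_clinear \<tau>" using \<tau> by (simp add: unitary_op_def isometry_op_def)
  have W2lin: "bounded_clinear W2" using W(2) by (simp add: unitary_op_def isometry_op_def)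
  have pointwise: "V2 (adj V1 x) = q *\<^sub>C adj V1 (V2 x) \<longleftrightarrow> D (C (hcoeff (fst (\<tau> x)) 0)) = 0" for x
  proof -
    have "V2 (adj V1 x) = q *\<^sub>C adj V1 (V2 x) \<longleftrightarrow> \<tau> (V2 (adj V1 x)) = \<tau> (q *\<^sub>C adj V1 (V2 x))"
      by (metis adj_unitary_cancel(1)[OF \<tau>])
    \<comment> \<open>The equation splits into the two summands, and its unitary component always
      holds.\<close>
    also have "\<dots> \<longleftrightarrow> T2 (S (fst (\<tau> x))) = q *\<^sub>C S (T2 (fst (\<tau> x)))"
      by (simp add: \<tau>2 adjV bounded_clinearD[OF \<tau>lin] scaleC_prod_def prod_eq_iff
          unitary_doubly_q_commutative[OF W(1) W2lin W(3)])
    finally show ?thesis by (simp add: model)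
  qed
  \<comment> \<open>The witness is the constant function \<open>y\<close>, paired with 0 in the
    unitary summand and pulled back by \<tau>.\<close>
  have onto: "\<exists>x. hcoeff (fst (\<tau> x)) 0 = y" for y
  proof -
    define a where "a n = (if n = 0 then y else 0)" for n :: nat
    have "sqsum a"
      unfolding sqsum_def by (rule summable_finite[of "{0}"]) (auto simp: a_def)
    then have "hcoeff (Abs_hardy (disk_series a)) = a" by (rule hardy_of_coeff)
    then have "hcoeff (fst (\<tau> (adj \<tau> (Abs_hardy (disk_series a), 0)))) 0 = y"
      by (simp add: adj_unitary_cancel[OF \<tau>] a_def)
    then show ?thesis by blast
  qed
  have "doubly_q_commutative q V1 V2 \<longleftrightarrow> (\<forall>x. D (C (hcoeff (fst (\<tau> x)) 0)) = 0)"
    using V by (simp add: doubly_q_commutative_def fun_eq_iff pointwise)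
  also have "\<dots> \<longleftrightarrow> (\<forall>x. D (C x) = 0)" using onto by metis
  finally show ?thesis .
qed

section \<open>The two BCL models\<close>

lemma BCL1_doubly_q_commutative_iff:
  assumes q: "cmod q = 1" and V: "q_commutative q V1 V2" and T: "BCL1_tuple q V1 V2 P U W1 W2"
  shows "doubly_q_commutative q V1 V2 \<longleftrightarrow> P \<circ> U \<circ> perp P = (\<lambda>x. 0)"
proof -
  have P: "bounded_clinear P" "\<And>x y. cinner (P x) y = cinner x (P y)" and U: "unitary_op U"
    using T by (auto simp: BCL1_tuple_def orth_projection_def)
  have W: "unitary_op W1" "unitary_op W2" "q_commutative q W1 W2"
    using T by (auto simp: BCL1_tuple_def)
  note equiv = T[unfolded BCL1_tuple_def, THEN conjunct2, THEN conjunct2, THEN conjunct2,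
      THEN conjunct2, THEN conjunct2]
  have perp: "cinner (perp P x) y = cinner x (perp P y)" for x y
    by (simp add: perp_def cinner_diff_left cinner_diff_right P)
  have lin: "bounded_clinear U" "bounded_clinear (adj U)"
    using U isometry_op_adj_unitary[OF U] by (auto simp: unitary_op_def isometry_op_def)
  note adjU = cinner_adj_unitary[OF U]
  \<comment> \<open>Here \<open>A = perp P \<circ> U\<close> and \<open>B = P \<circ> U\<close>,
    whose adjoints are \<open>D = adj U \<circ> perp P\<close> and
    \<open>C = adj U \<circ> P\<close>.\<close>
  have "doubly_q_commutative q V1 V2 \<longleftrightarrow> (\<forall>x. (adj U \<circ> perp P) ((adj U \<circ> P) x) = 0)"
    by (rule model_doubly_q_commutative_iff[OF _ _ _ _ _ _ _ _ _ _ equiv])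
      (use W V q lin in \<open>simp_all add: P perp adjU bounded_clinear_comp bounded_clinear_perp\<close>)
  \<comment> \<open>The outer factor \<open>adj U\<close> is injective and can be cancelled on the
    left.\<close>
  also have "\<dots> \<longleftrightarrow> (\<forall>x. perp P (adj U (P x)) = 0)"
    by (metis adj_unitary_cancel(2)[OF U] bounded_clinearD(3)[OF lin(1)]
        bounded_clinearD(3)[OF lin(2)] comp_apply)
  \<comment> \<open>The two operators are adjoint to each other, so they vanish together.\<close>
  also have "\<dots> \<longleftrightarrow> (\<forall>y. P (U (perp P y)) = 0)"
  proof -
    have "cinner (P (U (perp P y))) x = cinner y (perp P (adj U (P x)))" for x y
      by (simp add: P perp adjU)
    then show ?thesis
      by (metis cinner_commute cinner_zero_left cinner_zero_right eq_zero_if_cinner_zero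
          complex_cnj_zero)
  qed
  finally show ?thesis by (simp add: fun_eq_iff)
qed

lemma BCL2_doubly_q_commutative_iff:
  assumes q: "cmod q = 1" and V: "q_commutative q V1 V2" and T: "BCL2_tuple q V1 V2 P U W1 W2"
  shows "doubly_q_commutative q V1 V2 \<longleftrightarrow> perp P \<circ> U \<circ> P = (\<lambda>x. 0)"
proof -
  have P: "bounded_clinear P" "\<And>x y. cinner (P x) y = cinner x (P y)" and U: "unitary_op U"
    using T by (auto simp: BCL2_tuple_def orth_projection_def)
  have W: "unitary_op W1" "unitary_op W2" "q_commutative q W1 W2"
    using T by (auto simp: BCL2_tuple_def)
  note equiv = T[unfolded BCL2_tuple_def, THEN conjunct2, THEN conjunct2, THEN conjunct2,
      THEN conjunct2, THEN conjunct2]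
  have perp: "cinner (perp P x) y = cinner x (perp P y)" for x y
    by (simp add: perp_def cinner_diff_left cinner_diff_right P)
  have lin: "bounded_clinear U" "bounded_clinear (adj U)"
    using U isometry_op_adj_unitary[OF U] by (auto simp: unitary_op_def isometry_op_def)
  have adjU: "cinner (adj U x) y = cinner x (U y)" for x y
    by (metis cinner_adj_unitary[OF U] cinner_commute)
  \<comment> \<open>Now \<open>A = adj U \<circ> perp P\<close> and
    \<open>B = adj U \<circ> P\<close>, so \<open>D = perp P \<circ> U\<close> and
    \<open>C = P \<circ> U\<close>.\<close>
  have "doubly_q_commutative q V1 V2 \<longleftrightarrow> (\<forall>x. (perp P \<circ> U) ((P \<circ> U) x) = 0)"
    by (rule model_doubly_q_commutative_iff[OF _ _ _ _ _ _ _ _ _ _ equiv])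
      (use W V q lin in \<open>simp_all add: P perp adjU bounded_clinear_comp bounded_clinear_perp\<close>)
  \<comment> \<open>The innermost \<open>U\<close> is surjective and cancels on the right; the
    condition already has the claimed form without taking adjoints.\<close>
  also have "\<dots> \<longleftrightarrow> (\<forall>x. perp P (U (P x)) = 0)"
    by (metis adj_unitary_cancel(2)[OF U] comp_apply)
  finally show ?thesis by (simp add: fun_eq_iff)
qed

theorem theorem3p1:
  fixes q :: complex
    and V1 V2 :: "'h::chilbert_space \<Rightarrow> 'h"
    and P U :: "'f::chilbert_space \<Rightarrow> 'f"
    and W1 W2 :: "'k::chilbert_space \<Rightarrow> 'k"
    and Pd Ud :: "'fd::chilbert_space \<Rightarrow> 'fd"
    and W1d W2d :: "'kd::chilbert_space \<Rightarrow> 'kd"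
  assumes "cmod q = 1"
    and "isometry_op V1" and "isometry_op V2" and "q_commutative q V1 V2"
    and "BCL1_tuple q V1 V2 P U W1 W2"
    and "BCL2_tuple q V1 V2 Pd Ud W1d W2d"
  shows "(doubly_q_commutative q V1 V2 \<longleftrightarrow> P \<circ> U \<circ> perp P = (\<lambda>x. 0)) \<and>
         (P \<circ> U \<circ> perp P = (\<lambda>x. 0) \<longleftrightarrow> perp Pd \<circ> Ud \<circ> Pd = (\<lambda>x. 0))"
  using BCL1_doubly_q_commutative_iff[OF assms(1,4,5)] BCL2_doubly_q_commutative_iff[OF assms(1,4,6)]
  by blast

end
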